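(* Let $\Pi$ be a program (in the sense of the context). If every aggregate literal that is recursive with respect to $\Pi$ is positive, then the FLP-stable models of $\Pi$ are the same as the FT-stable models of $\Pi$.
   Context: \textbf{Infinitary formulas.} For a set $\sigma$ of propositional atoms, let $\mathcal F_0=\sigma$ and let $\mathcal F_{i+1}$ be obtained from $\mathcal F_i$ by adding $\mathcal H^\land$ and $\mathcal H^\lor$ for all subsets $\mathcal H\subseteq\mathcal F_i$ and $F\to G$ for all $F,G\in\mathcal F_i$; formulas are the elements of $\bigcup_i\mathcal F_i$. $\top=\emptyset^\land$, $\bot=\emptyset^\lor$, $\neg F = F\to\bot$. Interpretations are subsets $I\subseteq\sigma$; $I\models p$ iff $p\in I$; $I\models\mathcal H^\land$ iff $I$ satisfies every member; $I\models\mathcal H^\lor$ iff $I$ satisfies some member; $I\models F\to G$ iff $I\not\models F$ or $I\models G$. \textbf{FLP-stable models of formulas.} For a set $\mathcal H$ of formulas $G\to H$ with $H$ a disjunction of atoms, the FLP-reduct $FLP(\mathcal H,I)$ is the set of those $G\to H$ in $\mathcal H$ with $I\models G$; $I$ is an FLP-stable model of $\mathcal H$ if it is a $\subseteq$-minimal model of $FLP(\mathcal H,I)$. \textbf{FT-stable models of formulas.} $FT(p,I)=p$ if $p\in I$ and $\bot$ otherwise; $FT(\mathcal H^\land,I)=\{FT(G,I):G\in\mathcal H\}^\land$; similarly for $\lor$; $FT(G\to H,I)=\bot$ if $I\not\models G\to H$, otherwise $FT(G,I)\to FT(H,I)$. For a set of formulas the reduct is taken elementwise; $I$ is an FT-stable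 model of $\mathcal H$ if it is a $\subseteq$-minimal model of $FT(\mathcal H,I)$. \textbf{Syntax of programs.} There are pairwise disjoint sets of numerals (in a fixed bijection $n\mapsto\overline n$ with $\mathbb Z$), symbolic constants, and variables, plus the symbols $+,-,\times,/$, $\mathit{inf},\mathit{sup}$, comparison symbols $=,\neq,<,>,\le,\ge$, and aggregate names $\mathit{count},\mathit{sum},\mathit{max},\mathit{min}$. Terms: numerals, symbolic constants, variables, $\mathit{inf}$, $\mathit{sup}$; $f(\mathbf t)$ for a symbolic constant $f$ and non-empty tuple $\mathbf t$ of terms; $(t_1\star t_2)$ for $\star\in\{+,-,\times,/\}$. A term is ground if it has no variables and precomputed if it has neither variables nor arithmetic operation symbols. Fix a total order on precomputed terms with least element $\mathit{inf}$, greatest element $\mathit{sup}$, and $\overline m\le\overline n$ iff $m\le n$. The weight of a tuple of precomputed terms is $n$ if its first member is $\overline n$, and $0$ otherwise. For a set $T$ of tuples of precomputed terms: $\widehat{count}(T)$ is $\overline{|T|}$ if $T$ is finite, else $\mathit{sup}$; $\widehat{sum}(T)$ is the numeral for the sum of weights if finitely many tuples have nonzero weight, else $\mathit{sup}$; $\widehat{min}(T)$ is $\mathit{sup}$ if $T=\emptyset$, the least first element of the tuples if $T$ finite non-empty, $\mathit{inf}$ if $T$ is infinite; $\widehat{max}(T)$ is $\mathit{inf}$ if $T=\emptyset$, the greatest first element if $T$ finite non-empty, $\mathit{sup}$ if infinite. An atom is $p(\mathbf t)$ with $p$ a symbolic constant and $\mathbf t$ a tuple of terms; symbolic literals are $A$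 and $\mathit{not}\ A$ for atoms $A$; arithmetic literals are $t_1\prec t_2$ with $\prec$ a comparison symbol; literals are symbolic or arithmetic literals. An aggregate atom is $\alpha\{\mathbf t:\mathbf L\}\prec s$ with $\alpha$ an aggregate name, $\mathbf t$ a tuple of terms, $\mathbf L$ a tuple of literals, $\prec$ a comparison symbol and $s$ a term; aggregate literals are $E$ (positive) and $\mathit{not}\ E$ (negative) for aggregate atoms $E$. A rule is $H_1\lor\dots\lor H_k\leftarrow B_1\land\dots\land B_n$ ($k,n\ge0$) with atoms $H_i$ and literals or aggregate literals $B_j$; a program is a finite set of rules. A variable is global in a symbolic/arithmetic literal if it occurs in it, in an aggregate atom or its negation if it occurs in $s$, in a rule if it is global in some $H_i$ or $B_j$. \textbf{Semantics of terms.} Numerals, symbolic constants, $\mathit{inf}$, $\mathit{sup}$ are well-formed with value themselves; $f(t_1,\dots,t_n)$ is well-formed if all $t_i$ are, with value $f(val(t_1),\dots,val(t_n))$; $(t_1+t_2)$, $(t_1-t_2)$, $(t_1\times t_2)$ are well-formed if $val(t_1)=\overline{n_1}$, $val(t_2)=\overline{n_2}$ are numerals, with value $\overline{n_1+n_2}$ etc.; $(t_1/t_2)$ is well-formed if moreover $n_2\ne0$, with value $\overline{\lfloor n_1/n_2\rfloor}$. Tuples are well-formed componentwise. A closed (no global variables) arithmetic literal $t_1\prec t_2$ is well-formed if $t_1,t_2$ are, and true if $val(t_1)\prec val(t_2)$; a closed symbolic literal is well-formed if its argument tuple is; a closed aggregate literal is well-formed if $s$ is. A tuple of well-formed literals is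 nontrivial if all arithmetic literals in it are true. \textbf{Translations.} Let $\sigma_0$ be the set of atoms $p(\mathbf t)$ with $\mathbf t$ precomputed. For $\tau'\in\{\tau,\tau_1\}$: $\tau'(p(\mathbf t))=p(val(\mathbf t))$, $\tau'(\mathit{not}\ p(\mathbf t))=\neg p(val(\mathbf t))$; for a nontrivial tuple $\mathbf L$ of well-formed literals/aggregate literals, $\tau'\mathbf L$ is the conjunction of $\tau' L$ over the symbolic and aggregate literals $L$ in $\mathbf L$. For a well-formed aggregate atom $E=\alpha\{\mathbf t:\mathbf L\}\prec s$, let $\mathbf x$ be the variables occurring in $\mathbf t:\mathbf L$ and $A$ the set of tuples $\mathbf r$ of precomputed terms such that $\mathbf t^{\mathbf x}_{\mathbf r}$ is well-formed and $\mathbf L^{\mathbf x}_{\mathbf r}$ is well-formed and nontrivial. For $\Delta\subseteq A$, $val(\Delta)=\{val(\mathbf t^{\mathbf x}_{\mathbf r}):\mathbf r\in\Delta\}$; $\Delta$ justifies $E$ if $\widehat\alpha(val(\Delta))\prec val(s)$. Then $\tau_1E$ is the disjunction over justifying $\Delta$ of $\bigwedge_{\mathbf r\in\Delta}\tau_1(\mathbf L^{\mathbf x}_{\mathbf r})\land\bigwedge_{\mathbf r\in A\setminus\Delta}\neg\tau_1(\mathbf L^{\mathbf x}_{\mathbf r})$, and $\tau E$ is the conjunction over non-justifying $\Delta$ of $\bigwedge_{\mathbf r\in\Delta}\tau(\mathbf L^{\mathbf x}_{\mathbf r})\to\bigvee_{\mathbf r\in A\setminus\Delta}\tau(\mathbf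 L^{\mathbf x}_{\mathbf r})$. $\tau'(\mathit{not}\ E)=\neg\tau' E$. For a rule $R$ with global variables $\mathbf x$, $\tau' R$ is the set of formulas $\tau'((B_1,\dots,B_n)^{\mathbf x}_{\mathbf r})\to\tau'(H_1)^{\mathbf x}_{\mathbf r}\lor\dots\lor\tau'(H_k)^{\mathbf x}_{\mathbf r}$ over all tuples $\mathbf r$ of precomputed terms such that $(B_1,\dots,B_n)^{\mathbf x}_{\mathbf r}$ is well-formed and nontrivial and all $(H_i)^{\mathbf x}_{\mathbf r}$ are well-formed; $\tau'\Pi=\bigcup_{R\in\Pi}\tau' R$. The FLP-stable models of $\Pi$ are the FLP-stable models of $\tau_1\Pi$; the FT-stable models of $\Pi$ are the FT-stable models of $\tau\Pi$ (interpretations of $\sigma_0$). \textbf{Recursion.} The predicate symbol of $p(t_1,\dots,t_n)$ is $p/n$. The predicate dependency graph of $\Pi$ has as vertices the predicate symbols of atoms occurring in $\Pi$ and an edge from $p/n$ to $q/m$ if some rule of $\Pi$ has an atom with symbol $p/n$ in its head and an atom with symbol $q/m$ in its body (including inside aggregates). An occurrence of an aggregate literal $L$ in a rule $R\in\Pi$ is recursive with respect to $\Pi$ if for some predicate symbol $p/n$ occurring in $L$ and some $q/m$ occurring in the head of $R$ there is a path from $p/n$ to $q/m$ in this graph. An aggregate literal is positive if it is an aggregate atom (not of the form $\mathit{not}\ E$) and all symbolic literals occurring in it are atoms (not of the form $\mathit{not}\ A$). *)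

theory Defs
  imports Main
begin

section \<open>Infinitary propositional formulas\<close>

text \<open>
  A type closed under conjunctions and disjunctions of arbitrary sets of its own elements cannot
  exist, by Cantor's theorem, so branching is bounded by the cardinality of an index
  type \<open>'i\<close>; programs are translated below with an index type large enough for every conjunction
  and disjunction that occurs (lemma \<open>tau_formulas\<close>). The constructors take an indexed family;
  \<open>BigAnd\<close> and \<open>BigOr\<close> turn a set of formulas into a formula through one fixed
  indexing of that set.
\<close>

datatype ('a, 'i) form =
    Atom 'a
  | Conj "'i set" "'i \<Rightarrow> ('a, 'i) form"
  | Disj "'i set" "'i \<Rightarrow> ('a, 'i) form"
  | Imp "('a, 'i) form" "('a, 'i) form"

definition small :: "('a, 'i) form set \<Rightarrow> bool" where
  "small H \<longleftrightarrow> (\<exists>f :: 'i \<Rightarrow> ('a, 'i) form. H \<subseteq> range f)"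

definition enum_of :: "('a, 'i) form set \<Rightarrow> 'i \<Rightarrow> ('a, 'i) form" where
  "enum_of H = (SOME f. H \<subseteq> range f)"

definition BigAnd :: "('a, 'i) form set \<Rightarrow> ('a, 'i) form" where
  "BigAnd H = Conj {i. enum_of H i \<in> H} (enum_of H)"

definition BigOr :: "('a, 'i) form set \<Rightarrow> ('a, 'i) form" where
  "BigOr H = Disj {i. enum_of H i \<in> H} (enum_of H)"

primrec formula_level :: "nat \<Rightarrow> ('a, 'i) form set" where
  "formula_level 0 = range Atom"
| "formula_level (Suc n) = formula_level n
     \<union> {BigAnd H | H. H \<subseteq> formula_level n \<and> small H}
     \<union> {BigOr H | H. H \<subseteq> formula_level n \<and> small H}
     \<union> {Imp F G | F G. F \<in> formula_level n \<and> G \<in> formula_level n}"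

definition formulas :: "('a, 'i) form set" where
  "formulas = (\<Union>n. formula_level n)"

abbreviation FBot :: "('a, 'i) form" where
  "FBot \<equiv> BigOr {}"

abbreviation FNot :: "('a, 'i) form \<Rightarrow> ('a, 'i) form" where
  "FNot F \<equiv> Imp F FBot"

abbreviation FAnd :: "('a, 'i) form \<Rightarrow> ('a, 'i) form \<Rightarrow> ('a, 'i) form" where
  "FAnd F G \<equiv> BigAnd {F, G}"

primrec sat :: "'a set \<Rightarrow> ('a, 'i) form \<Rightarrow> bool" where
  "sat I (Atom p) \<longleftrightarrow> p \<in> I"
| "sat I (Conj K f) \<longleftrightarrow> (\<forall>i\<in>K. sat I (f i))"
| "sat I (Disj K f) \<longleftrightarrow> (\<exists>i\<in>K. sat I (f i))"
| "sat I (Imp F G) \<longleftrightarrow> \<not> sat I F \<or> sat I G"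

definition models :: "'a set \<Rightarrow> ('a, 'i) form set \<Rightarrow> bool" where
  "models I H \<longleftrightarrow> (\<forall>F\<in>H. sat I F)"

definition minimal_model :: "'a set \<Rightarrow> ('a, 'i) form set \<Rightarrow> bool" where
  "minimal_model I H \<longleftrightarrow> models I H \<and> (\<forall>J. J \<subset> I \<longrightarrow> \<not> models J H)"

definition FLP :: "('a, 'i) form set \<Rightarrow> 'a set \<Rightarrow> ('a, 'i) form set" where
  "FLP H I = {Imp F G | F G. Imp F G \<in> H \<and> sat I F}"

definition FLP_stable :: "('a, 'i) form set \<Rightarrow> 'a set \<Rightarrow> bool" where
  "FLP_stable H I \<longleftrightarrow> minimal_model I (FLP H I)"

primrec FT :: "'a set \<Rightarrow> ('a, 'i) form \<Rightarrow> ('a, 'i) form" where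
  "FT I (Atom p) = (if p \<in> I then Atom p else FBot)"
| "FT I (Conj K f) = BigAnd ((\<lambda>i. FT I (f i)) ` K)"
| "FT I (Disj K f) = BigOr ((\<lambda>i. FT I (f i)) ` K)"
| "FT I (Imp F G) = (if sat I (Imp F G) then Imp (FT I F) (FT I G) else FBot)"

definition FT_stable :: "('a, 'i) form set \<Rightarrow> 'a set \<Rightarrow> bool" where
  "FT_stable H I \<longleftrightarrow> minimal_model I (FT I ` H)"

lemma enum_of_image:
  assumes "small H"
  shows "enum_of H ` {i. enum_of H i \<in> H} = H"
proof -
  have "H \<subseteq> range (enum_of H)"
    using assms unfolding small_def enum_of_def by (rule someI_ex)
  then show ?thesis by auto
qed

lemma sat_BigAnd: "small H \<Longrightarrow> sat I (BigAnd H) \<longleftrightarrow> (\<forall>F\<in>H. sat I F)"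
  by (subst (2) enum_of_image[symmetric]) (auto simp: BigAnd_def)

lemma sat_BigOr: "small H \<Longrightarrow> sat I (BigOr H) \<longleftrightarrow> (\<exists>F\<in>H. sat I F)"
  by (subst (2) enum_of_image[symmetric]) (auto simp: BigOr_def)

lemma FT_BigAnd: "small H \<Longrightarrow> FT I (BigAnd H) = BigAnd (FT I ` H)"
  using enum_of_image[of H] by (simp add: BigAnd_def image_image[symmetric])

lemma FT_BigOr: "small H \<Longrightarrow> FT I (BigOr H) = BigOr (FT I ` H)"
  using enum_of_image[of H] by (simp add: BigOr_def image_image[symmetric])

lemma BigAnd_inject: "small H \<Longrightarrow> small K \<Longrightarrow> BigAnd H = BigAnd K \<longleftrightarrow> H = K"
  by (metis BigAnd_def form.inject(2) enum_of_image)

lemma BigOr_inject: "small H \<Longrightarrow> small K \<Longrightarrow> BigOr H = BigOr K \<longleftrightarrow> H = K"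
  by (metis BigOr_def form.inject(3) enum_of_image)


section \<open>Syntax of programs\<close>

datatype arith_op = OpAdd | OpSub | OpMul | OpDiv

datatype comparison = CEq | CNe | CLt | CGt | CLe | CGe

datatype agg_fun = AggCount | AggSum | AggMax | AggMin

text \<open>The argument tuple of \<open>Fn\<close> is non-empty: its first member is a separate argument.\<close>

datatype ('c, 'v) trm =
    Num int
  | Sym 'c
  | Var 'v
  | TInf
  | TSup
  | Fn 'c "('c, 'v) trm" "('c, 'v) trm list"
  | Arith arith_op "('c, 'v) trm" "('c, 'v) trm"

datatype 'c pterm =
    PNum int
  | PSym 'c
  | PInf
  | PSup
  | PFn 'c "'c pterm" "'c pterm list"

primrec trm_of :: "'c pterm \<Rightarrow> ('c, 'v) trm" where
  "trm_of (PNum n) = Num n"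
| "trm_of (PSym c) = Sym c"
| "trm_of PInf = TInf"
| "trm_of PSup = TSup"
| "trm_of (PFn f t ts) = Fn f (trm_of t) (map trm_of ts)"

primrec precomputed :: "('c, 'v) trm \<Rightarrow> bool" where
  "precomputed (Num n) \<longleftrightarrow> True"
| "precomputed (Sym c) \<longleftrightarrow> True"
| "precomputed (Var x) \<longleftrightarrow> False"
| "precomputed TInf \<longleftrightarrow> True"
| "precomputed TSup \<longleftrightarrow> True"
| "precomputed (Fn f t ts) \<longleftrightarrow> precomputed t \<and> (\<forall>b\<in>set (map precomputed ts). b)"
| "precomputed (Arith q t1 t2) \<longleftrightarrow> False"

lemma range_trm_of: "range trm_of = {t. precomputed t}"
proof (intro equalityI subsetI)
  fix t :: "('a, 'b) trm" assume "t \<in> range trm_of"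
  then obtain p :: "'a pterm" where "t = trm_of p" by blast
  moreover have "precomputed (trm_of p :: ('a, 'b) trm)" by (induction p) auto
  ultimately show "t \<in> {t. precomputed t}" by simp
next
  fix t :: "('a, 'b) trm" assume "t \<in> {t. precomputed t}"
  then have "precomputed t" by simp
  then show "t \<in> range trm_of"
  proof (induction t)
    case (Fn f t ts)
    then have "t \<in> range trm_of" and "\<forall>u\<in>set ts. u \<in> range trm_of" by auto
    then obtain p ps where "t = trm_of p" and "ts = map trm_of ps"
      by (metis ex_map_conv imageE)
    then have "Fn f t ts = trm_of (PFn f p ps)" by simp
    then show ?case by (rule range_eqI)
  qed (auto intro: range_eqI trm_of.simps[symmetric])
qed

lemma inj_trm_of: "inj trm_of"
proof (rule injI)
  fix p q :: "'a pterm" assume "(trm_of p :: ('a, 'b) trm) = trm_of q"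
  then show "p = q"
  proof (induction p arbitrary: q)
    case (PFn f p ps)
    then obtain q' qs where q: "q = PFn f q' qs" by (cases q) auto
    with PFn have "p = q'" and "map trm_of ps = (map trm_of qs :: ('a, 'b) trm list)" by auto
    then have "ps = qs"
      using PFn.IH(2) by (auto intro!: list.inj_map_strong[of ps qs trm_of trm_of])
    with q \<open>p = q'\<close> show ?case by simp
  qed (case_tac q; simp)+
qed

datatype ('c, 'v) atom = Atm (atom_pred: 'c) (atom_args: "('c, 'v) trm list")

datatype ('c, 'v) lit =
    Pos "('c, 'v) atom"
  | Neg "('c, 'v) atom"
  | Cmp "('c, 'v) trm" comparison "('c, 'v) trm"

datatype ('c, 'v) agg =
  Agg (agg_name: agg_fun) (agg_tuple: "('c, 'v) trm list") (agg_cond: "('c, 'v) lit list")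
    (agg_cmp: comparison) (agg_bound: "('c, 'v) trm")

datatype ('c, 'v) body_lit =
    Lit "('c, 'v) lit"
  | PosAgg "('c, 'v) agg"
  | NegAgg "('c, 'v) agg"

datatype ('c, 'v) rule = Rule (head: "('c, 'v) atom list") (body: "('c, 'v) body_lit list")

primrec symbolic :: "('c, 'v) lit \<Rightarrow> bool" where
  "symbolic (Pos A) \<longleftrightarrow> True"
| "symbolic (Neg A) \<longleftrightarrow> True"
| "symbolic (Cmp t1 c t2) \<longleftrightarrow> False"

primrec aggregate_lit :: "('c, 'v) body_lit \<Rightarrow> bool" where
  "aggregate_lit (Lit L) \<longleftrightarrow> False"
| "aggregate_lit (PosAgg E) \<longleftrightarrow> True"
| "aggregate_lit (NegAgg E) \<longleftrightarrow> True"

subsection \<open>Variables and substitution\<close>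

primrec vars_trm :: "('c, 'v) trm \<Rightarrow> 'v list" where
  "vars_trm (Num n) = []"
| "vars_trm (Sym c) = []"
| "vars_trm (Var x) = [x]"
| "vars_trm TInf = []"
| "vars_trm TSup = []"
| "vars_trm (Fn f t ts) = vars_trm t @ concat (map vars_trm ts)"
| "vars_trm (Arith q t1 t2) = vars_trm t1 @ vars_trm t2"

definition vars_atom :: "('c, 'v) atom \<Rightarrow> 'v list" where
  "vars_atom A = concat (map vars_trm (atom_args A))"

primrec vars_lit :: "('c, 'v) lit \<Rightarrow> 'v list" where
  "vars_lit (Pos A) = vars_atom A"
| "vars_lit (Neg A) = vars_atom A"
| "vars_lit (Cmp t1 c t2) = vars_trm t1 @ vars_trm t2"

primrec global_vars_lit :: "('c, 'v) body_lit \<Rightarrow> 'v list" where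
  "global_vars_lit (Lit L) = vars_lit L"
| "global_vars_lit (PosAgg E) = vars_trm (agg_bound E)"
| "global_vars_lit (NegAgg E) = vars_trm (agg_bound E)"

definition global_vars :: "('c, 'v) rule \<Rightarrow> 'v list" where
  "global_vars R =
     remdups (concat (map vars_atom (head R)) @ concat (map global_vars_lit (body R)))"

definition agg_vars :: "('c, 'v) agg \<Rightarrow> 'v list" where
  "agg_vars E =
     remdups (concat (map vars_trm (agg_tuple E)) @ concat (map vars_lit (agg_cond E)))"

type_synonym ('c, 'v) assignment = "'v \<Rightarrow> 'c pterm option"

primrec subst_trm :: "('c, 'v) assignment \<Rightarrow> ('c, 'v) trm \<Rightarrow> ('c, 'v) trm" where
  "subst_trm \<theta> (Num n) = Num n"
| "subst_trm \<theta> (Sym c) = Sym c"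
| "subst_trm \<theta> (Var x) = (case \<theta> x of None \<Rightarrow> Var x | Some r \<Rightarrow> trm_of r)"
| "subst_trm \<theta> TInf = TInf"
| "subst_trm \<theta> TSup = TSup"
| "subst_trm \<theta> (Fn f t ts) = Fn f (subst_trm \<theta> t) (map (subst_trm \<theta>) ts)"
| "subst_trm \<theta> (Arith q t1 t2) = Arith q (subst_trm \<theta> t1) (subst_trm \<theta> t2)"

definition subst_atom :: "('c, 'v) assignment \<Rightarrow> ('c, 'v) atom \<Rightarrow> ('c, 'v) atom" where
  "subst_atom \<theta> A = Atm (atom_pred A) (map (subst_trm \<theta>) (atom_args A))"

primrec subst_lit :: "('c, 'v) assignment \<Rightarrow> ('c, 'v) lit \<Rightarrow> ('c, 'v) lit" where
  "subst_lit \<theta> (Pos A) = Pos (subst_atom \<theta> A)"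
| "subst_lit \<theta> (Neg A) = Neg (subst_atom \<theta> A)"
| "subst_lit \<theta> (Cmp t1 c t2) = Cmp (subst_trm \<theta> t1) c (subst_trm \<theta> t2)"

definition subst_agg :: "('c, 'v) assignment \<Rightarrow> ('c, 'v) agg \<Rightarrow> ('c, 'v) agg" where
  "subst_agg \<theta> E = Agg (agg_name E) (map (subst_trm \<theta>) (agg_tuple E))
     (map (subst_lit \<theta>) (agg_cond E)) (agg_cmp E) (subst_trm \<theta> (agg_bound E))"

primrec subst_body_lit :: "('c, 'v) assignment \<Rightarrow> ('c, 'v) body_lit \<Rightarrow> ('c, 'v) body_lit" where
  "subst_body_lit \<theta> (Lit L) = Lit (subst_lit \<theta> L)"
| "subst_body_lit \<theta> (PosAgg E) = PosAgg (subst_agg \<theta> E)"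
| "subst_body_lit \<theta> (NegAgg E) = NegAgg (subst_agg \<theta> E)"

definition assign :: "'v list \<Rightarrow> 'c pterm list \<Rightarrow> ('c, 'v) assignment" where
  "assign xs r = map_of (zip xs r)"


section \<open>Semantics of terms and literals\<close>

text \<open>\<open>val t\<close> is \<open>None\<close> exactly when \<open>t\<close> is not well-formed, in particular when it is not ground.\<close>

primrec val_arith :: "arith_op \<Rightarrow> int \<Rightarrow> int \<Rightarrow> 'c pterm option" where
  "val_arith OpAdd m n = Some (PNum (m + n))"
| "val_arith OpSub m n = Some (PNum (m - n))"
| "val_arith OpMul m n = Some (PNum (m * n))"
| "val_arith OpDiv m n = (if n = 0 then None else Some (PNum (m div n)))"

primrec val :: "('c, 'v) trm \<Rightarrow> 'c pterm option" where
  "val (Num n) = Some (PNum n)"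
| "val (Sym c) = Some (PSym c)"
| "val (Var x) = None"
| "val TInf = Some PInf"
| "val TSup = Some PSup"
| "val (Fn f t ts) =
     (case (val t, those (map val ts)) of (Some v, Some vs) \<Rightarrow> Some (PFn f v vs) | _ \<Rightarrow> None)"
| "val (Arith q t1 t2) =
     (case (val t1, val t2) of (Some (PNum m), Some (PNum n)) \<Rightarrow> val_arith q m n | _ \<Rightarrow> None)"

definition vals :: "('c, 'v) trm list \<Rightarrow> 'c pterm list option" where
  "vals ts = those (map val ts)"

definition wf_trm :: "('c, 'v) trm \<Rightarrow> bool" where
  "wf_trm t \<longleftrightarrow> val t \<noteq> None"

definition wf_tuple :: "('c, 'v) trm list \<Rightarrow> bool" where
  "wf_tuple ts \<longleftrightarrow> (\<forall>t\<in>set ts. wf_trm t)"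

lemma wf_tuple_iff: "wf_tuple ts \<longleftrightarrow> vals ts \<noteq> None"
  by (induction ts) (auto simp: wf_tuple_def wf_trm_def vals_def split: option.splits)

definition wf_atom :: "('c, 'v) atom \<Rightarrow> bool" where
  "wf_atom A \<longleftrightarrow> wf_tuple (atom_args A)"

primrec wf_lit :: "('c, 'v) lit \<Rightarrow> bool" where
  "wf_lit (Pos A) \<longleftrightarrow> wf_atom A"
| "wf_lit (Neg A) \<longleftrightarrow> wf_atom A"
| "wf_lit (Cmp t1 c t2) \<longleftrightarrow> wf_trm t1 \<and> wf_trm t2"

primrec wf_body_lit :: "('c, 'v) body_lit \<Rightarrow> bool" where
  "wf_body_lit (Lit L) \<longleftrightarrow> wf_lit L"
| "wf_body_lit (PosAgg E) \<longleftrightarrow> wf_trm (agg_bound E)"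
| "wf_body_lit (NegAgg E) \<longleftrightarrow> wf_trm (agg_bound E)"

text \<open>The total order on precomputed terms is a parameter \<open>le\<close> of everything below.\<close>

definition term_order :: "('c pterm \<Rightarrow> 'c pterm \<Rightarrow> bool) \<Rightarrow> bool" where
  "term_order le \<longleftrightarrow> linear_order {(x, y). le x y}
     \<and> (\<forall>x. le PInf x) \<and> (\<forall>x. le x PSup) \<and> (\<forall>m n. le (PNum m) (PNum n) \<longleftrightarrow> m \<le> n)"

primrec compare ::
  "('c pterm \<Rightarrow> 'c pterm \<Rightarrow> bool) \<Rightarrow> comparison \<Rightarrow> 'c pterm \<Rightarrow> 'c pterm \<Rightarrow> bool" where
  "compare le CEq x y \<longleftrightarrow> x = y"
| "compare le CNe x y \<longleftrightarrow> x \<noteq> y"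
| "compare le CLt x y \<longleftrightarrow> le x y \<and> x \<noteq> y"
| "compare le CGt x y \<longleftrightarrow> le y x \<and> x \<noteq> y"
| "compare le CLe x y \<longleftrightarrow> le x y"
| "compare le CGe x y \<longleftrightarrow> le y x"

primrec arith_true :: "('c pterm \<Rightarrow> 'c pterm \<Rightarrow> bool) \<Rightarrow> ('c, 'v) lit \<Rightarrow> bool" where
  "arith_true le (Pos A) \<longleftrightarrow> True"
| "arith_true le (Neg A) \<longleftrightarrow> True"
| "arith_true le (Cmp t1 c t2) \<longleftrightarrow> compare le c (the (val t1)) (the (val t2))"

definition nontrivial :: "('c pterm \<Rightarrow> 'c pterm \<Rightarrow> bool) \<Rightarrow> ('c, 'v) lit list \<Rightarrow> bool" where
  "nontrivial le Ls \<longleftrightarrow> (\<forall>L\<in>set Ls. arith_true le L)"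

definition nontrivial_body ::
  "('c pterm \<Rightarrow> 'c pterm \<Rightarrow> bool) \<Rightarrow> ('c, 'v) body_lit list \<Rightarrow> bool" where
  "nontrivial_body le Bs \<longleftrightarrow> (\<forall>L. Lit L \<in> set Bs \<longrightarrow> arith_true le L)"

fun weight :: "'c pterm list \<Rightarrow> int" where
  "weight (PNum n # ts) = n"
| "weight ts = 0"

definition firsts :: "'c pterm list set \<Rightarrow> 'c pterm set" where
  "firsts T = {t. \<exists>ts. t # ts \<in> T}"

text \<open>
  The value of \<open>AggMin\<close> and \<open>AggMax\<close> on the set containing just the empty tuple, which has no first
  member, is left unspecified.
\<close>

primrec agg_value ::
  "('c pterm \<Rightarrow> 'c pterm \<Rightarrow> bool) \<Rightarrow> agg_fun \<Rightarrow> 'c pterm list set \<Rightarrow> 'c pterm" where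
  "agg_value le AggCount T = (if finite T then PNum (int (card T)) else PSup)"
| "agg_value le AggSum T =
     (if finite {t \<in> T. weight t \<noteq> 0} then PNum (\<Sum>t \<in> {t \<in> T. weight t \<noteq> 0}. weight t) else PSup)"
| "agg_value le AggMax T =
     (if T = {} then PInf
      else if finite T then (THE x. x \<in> firsts T \<and> (\<forall>y\<in>firsts T. le y x))
      else PSup)"
| "agg_value le AggMin T =
     (if T = {} then PSup
      else if finite T then (THE x. x \<in> firsts T \<and> (\<forall>y\<in>firsts T. le x y))
      else PInf)"


section \<open>Translation of programs into infinitary formulas\<close>

datatype 'c gatom = GAtom 'c "'c pterm list"

text \<open>Disjuncts and conjuncts are indexed by sets of tuples of precomputed terms at most.\<close>

type_synonym 'c pform = "('c gatom, 'c pterm list set) form"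

definition tau_atom :: "('c, 'v) atom \<Rightarrow> 'c pform" where
  "tau_atom A = Atom (GAtom (atom_pred A) (the (vals (atom_args A))))"

primrec (nonexhaustive) tau_lit :: "('c, 'v) lit \<Rightarrow> 'c pform" where
  "tau_lit (Pos A) = tau_atom A"
| "tau_lit (Neg A) = FNot (tau_atom A)"

definition tau_lits :: "('c, 'v) lit list \<Rightarrow> 'c pform" where
  "tau_lits Ls = BigAnd {tau_lit L | L. L \<in> set Ls \<and> symbolic L}"

definition cond_inst :: "('c, 'v) agg \<Rightarrow> 'c pterm list \<Rightarrow> ('c, 'v) lit list" where
  "cond_inst E r = map (subst_lit (assign (agg_vars E) r)) (agg_cond E)"

definition tuple_inst :: "('c, 'v) agg \<Rightarrow> 'c pterm list \<Rightarrow> ('c, 'v) trm list" where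
  "tuple_inst E r = map (subst_trm (assign (agg_vars E) r)) (agg_tuple E)"

definition admissible ::
  "('c pterm \<Rightarrow> 'c pterm \<Rightarrow> bool) \<Rightarrow> ('c, 'v) agg \<Rightarrow> 'c pterm list set" where
  "admissible le E = {r. length r = length (agg_vars E) \<and> wf_tuple (tuple_inst E r)
     \<and> (\<forall>L\<in>set (cond_inst E r). wf_lit L) \<and> nontrivial le (cond_inst E r)}"

definition justifies ::
  "('c pterm \<Rightarrow> 'c pterm \<Rightarrow> bool) \<Rightarrow> ('c, 'v) agg \<Rightarrow> 'c pterm list set \<Rightarrow> bool" where
  "justifies le E \<Delta> \<longleftrightarrow>
     compare le (agg_cmp E) (agg_value le (agg_name E) ((\<lambda>r. the (vals (tuple_inst E r))) ` \<Delta>))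
       (the (val (agg_bound E)))"

definition tau1_agg :: "('c pterm \<Rightarrow> 'c pterm \<Rightarrow> bool) \<Rightarrow> ('c, 'v) agg \<Rightarrow> 'c pform" where
  "tau1_agg le E = BigOr
     {FAnd (BigAnd {tau_lits (cond_inst E r) | r. r \<in> \<Delta>})
           (BigAnd {FNot (tau_lits (cond_inst E r)) | r. r \<in> admissible le E - \<Delta>})
      | \<Delta>. \<Delta> \<subseteq> admissible le E \<and> justifies le E \<Delta>}"

definition tau_agg :: "('c pterm \<Rightarrow> 'c pterm \<Rightarrow> bool) \<Rightarrow> ('c, 'v) agg \<Rightarrow> 'c pform" where
  "tau_agg le E = BigAnd
     {Imp (BigAnd {tau_lits (cond_inst E r) | r. r \<in> \<Delta>})
          (BigOr {tau_lits (cond_inst E r) | r. r \<in> admissible le E - \<Delta>})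
      | \<Delta>. \<Delta> \<subseteq> admissible le E \<and> \<not> justifies le E \<Delta>}"

text \<open>
  The two translations differ only in their treatment of aggregate atoms, which is the
  argument \<open>T\<close> below.
\<close>

primrec tau_body_lit ::
  "(('c, 'v) agg \<Rightarrow> 'c pform) \<Rightarrow> ('c, 'v) body_lit \<Rightarrow> 'c pform" where
  "tau_body_lit T (Lit L) = tau_lit L"
| "tau_body_lit T (PosAgg E) = T E"
| "tau_body_lit T (NegAgg E) = FNot (T E)"

definition tau_body ::
  "(('c, 'v) agg \<Rightarrow> 'c pform) \<Rightarrow> ('c, 'v) body_lit list \<Rightarrow> 'c pform" where
  "tau_body T Bs =
     BigAnd {tau_body_lit T B | B. B \<in> set Bs \<and> (\<forall>L. B = Lit L \<longrightarrow> symbolic L)}"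

definition tau_rule ::
  "(('c, 'v) agg \<Rightarrow> 'c pform) \<Rightarrow> ('c pterm \<Rightarrow> 'c pterm \<Rightarrow> bool) \<Rightarrow> ('c, 'v) rule \<Rightarrow> 'c pform set" where
  "tau_rule T le R =
     {Imp (tau_body T Bs) (BigOr (tau_atom ` set Hs)) | Bs Hs r \<theta>.
        length r = length (global_vars R) \<and> \<theta> = assign (global_vars R) r
        \<and> Bs = map (subst_body_lit \<theta>) (body R) \<and> Hs = map (subst_atom \<theta>) (head R)
        \<and> (\<forall>B\<in>set Bs. wf_body_lit B) \<and> nontrivial_body le Bs \<and> (\<forall>H\<in>set Hs. wf_atom H)}"

definition tau1 :: "('c pterm \<Rightarrow> 'c pterm \<Rightarrow> bool) \<Rightarrow> ('c, 'v) rule set \<Rightarrow> 'c pform set" where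
  "tau1 le \<Pi> = (\<Union>R\<in>\<Pi>. tau_rule (tau1_agg le) le R)"

definition tau :: "('c pterm \<Rightarrow> 'c pterm \<Rightarrow> bool) \<Rightarrow> ('c, 'v) rule set \<Rightarrow> 'c pform set" where
  "tau le \<Pi> = (\<Union>R\<in>\<Pi>. tau_rule (tau_agg le) le R)"

definition FLP_stable_models ::
  "('c pterm \<Rightarrow> 'c pterm \<Rightarrow> bool) \<Rightarrow> ('c, 'v) rule set \<Rightarrow> 'c gatom set set" where
  "FLP_stable_models le \<Pi> = {I. FLP_stable (tau1 le \<Pi>) I}"

definition FT_stable_models ::
  "('c pterm \<Rightarrow> 'c pterm \<Rightarrow> bool) \<Rightarrow> ('c, 'v) rule set \<Rightarrow> 'c gatom set set" where
  "FT_stable_models le \<Pi> = {I. FT_stable (tau le \<Pi>) I}"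

subsection \<open>All conjunctions and disjunctions in the translations are small\<close>

lemma small_sets:
  fixes g :: "'c pterm list set \<Rightarrow> 'c pform"
  shows "small {g \<Delta> | \<Delta>. P \<Delta>}"
  unfolding small_def by blast

lemma small_tuples:
  fixes g :: "'c pterm list \<Rightarrow> 'c pform"
  shows "small {g r | r. P r}"
proof -
  have "{g r | r. P r} \<subseteq> range (\<lambda>\<Delta>. g (the_elem \<Delta>))"
  proof
    fix F assume "F \<in> {g r | r. P r}"
    then obtain r where "F = g (the_elem {r})" by auto
    then show "F \<in> range (\<lambda>\<Delta>. g (the_elem \<Delta>))" by (rule range_eqI)
  qed
  then show ?thesis unfolding small_def by blast
qed

lemma small_finite:
  fixes H :: "'c pform set"
  assumes "finite H"
  shows "small H"
proof -
  obtain xs where xs: "set xs = H" using assms finite_list by blast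
  have "H \<subseteq> range (\<lambda>\<Delta> :: 'c pterm list set. xs ! length (the_elem \<Delta>))"
  proof
    fix F assume "F \<in> H"
    then obtain n where "n < length xs" "F = xs ! n" using xs by (metis in_set_conv_nth)
    then show "F \<in> range (\<lambda>\<Delta> :: 'c pterm list set. xs ! length (the_elem \<Delta>))"
      by (intro range_eqI[of _ _ "{replicate n PInf}"]) simp
  qed
  then show ?thesis unfolding small_def by blast
qed

lemma formula_level_mono: "m \<le> n \<Longrightarrow> formula_level m \<subseteq> formula_level n"
  by (induction rule: dec_induct) auto

lemma BigAnd_level: "\<lbrakk>small H; H \<subseteq> formula_level n; n < m\<rbrakk> \<Longrightarrow> BigAnd H \<in> formula_level m"
  using formula_level_mono[of "Suc n" m] by auto

lemma BigOr_level: "\<lbrakk>small H; H \<subseteq> formula_level n; n < m\<rbrakk> \<Longrightarrow> BigOr H \<in> formula_level m"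
  using formula_level_mono[of "Suc n" m] by auto

lemma Imp_level:
  "\<lbrakk>F \<in> formula_level n; G \<in> formula_level n; n < m\<rbrakk> \<Longrightarrow> Imp F G \<in> formula_level m"
  using formula_level_mono[of "Suc n" m] by auto

lemma Bot_level: "0 < m \<Longrightarrow> (FBot :: 'c pform) \<in> formula_level m"
  by (rule BigOr_level[of _ 0]) (auto simp: small_finite)

lemma Not_level: "\<lbrakk>F \<in> formula_level n; 0 < n; n < m\<rbrakk> \<Longrightarrow> (FNot F :: 'c pform) \<in> formula_level m"
  by (rule Imp_level[of _ n]) (auto intro: Bot_level)

lemma tau_atom_level: "tau_atom A \<in> formula_level n"
  using formula_level_mono[of 0 n] by (auto simp: tau_atom_def)

lemma tau_lit_level: "symbolic L \<Longrightarrow> tau_lit L \<in> formula_level 2"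
  by (cases L) (auto intro!: tau_atom_level Not_level[of _ 1])

lemma tau_lits_level: "tau_lits Ls \<in> formula_level 3"
  unfolding tau_lits_def
  by (rule BigAnd_level[of _ 2]) (auto intro!: small_finite tau_lit_level)

lemma tau1_agg_level: "tau1_agg le E \<in> formula_level 7"
proof -
  have "BigAnd {tau_lits (cond_inst E r) | r. r \<in> \<Delta>} \<in> formula_level 5" for \<Delta>
    by (rule BigAnd_level[OF small_tuples, of _ _ 3]) (use tau_lits_level in auto)
  moreover have "FNot (tau_lits (cond_inst E r)) \<in> formula_level 4" for r
    by (rule Not_level[OF tau_lits_level]) auto
  then have "BigAnd {FNot (tau_lits (cond_inst E r)) | r. P r} \<in> formula_level 5" for P
    by (intro BigAnd_level[OF small_tuples, of _ _ 4]) auto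
  ultimately have "FAnd (BigAnd {tau_lits (cond_inst E r) | r. r \<in> \<Delta>})
      (BigAnd {FNot (tau_lits (cond_inst E r)) | r. P r}) \<in> formula_level 6" for \<Delta> P
    by (intro BigAnd_level[of _ 5] small_finite) auto
  then show ?thesis
    unfolding tau1_agg_def by (intro BigOr_level[OF small_sets, of _ _ 6] subsetI) (auto simp del: formula_level.simps)
qed

lemma tau_agg_level: "tau_agg le E \<in> formula_level 7"
proof -
  have "BigAnd {tau_lits (cond_inst E r) | r. P r} \<in> formula_level 5"
    "BigOr {tau_lits (cond_inst E r) | r. P r} \<in> formula_level 5" for P
    by (rule BigAnd_level[OF small_tuples, of _ _ 3] BigOr_level[OF small_tuples, of _ _ 3];
        use tau_lits_level in auto)+
  then have "Imp (BigAnd {tau_lits (cond_inst E r) | r. P r})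
      (BigOr {tau_lits (cond_inst E r) | r. Q r}) \<in> formula_level 6" for P Q
    by (intro Imp_level[of _ 5]) auto
  then show ?thesis
    unfolding tau_agg_def by (intro BigAnd_level[OF small_sets, of _ _ 6] subsetI) (auto simp del: formula_level.simps)
qed

lemma tau_rule_level:
  assumes T: "\<And>E. T E \<in> formula_level 7"
  shows "tau_rule T le R \<subseteq> formula_level 10"
proof -
  have lit: "tau_body_lit T B \<in> formula_level 8" if "\<forall>L. B = Lit L \<longrightarrow> symbolic L" for B
    using that T formula_level_mono[of 2 8] formula_level_mono[of 7 8]
    by (cases B) (auto dest: tau_lit_level intro: Not_level[of _ 7])
  have "tau_body T Bs \<in> formula_level 9" for Bs
    unfolding tau_body_def by (rule BigAnd_level[of _ 8]) (auto intro!: small_finite lit)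
  moreover have "BigOr (tau_atom ` set Hs) \<in> formula_level 9" for Hs :: "('a, 'b) atom list"
    by (rule BigOr_level[of _ 1]) (auto intro!: small_finite simp del: formula_level.simps intro: tau_atom_level)
  ultimately show ?thesis
    unfolding tau_rule_def by (auto intro!: Imp_level[of _ 9])
qed

lemma tau_formulas: "tau1 le \<Pi> \<subseteq> formulas" "tau le \<Pi> \<subseteq> formulas"
proof -
  have sub: "formula_level 10 \<subseteq> formulas"
    unfolding formulas_def by (rule UN_upper) simp
  show "tau1 le \<Pi> \<subseteq> formulas"
    unfolding tau1_def by (intro UN_least subset_trans[OF tau_rule_level sub] tau1_agg_level)
  show "tau le \<Pi> \<subseteq> formulas"
    unfolding tau_def by (intro UN_least subset_trans[OF tau_rule_level sub] tau_agg_level)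
qed


section \<open>Recursive aggregate literals\<close>

definition pred_sym :: "('c, 'v) atom \<Rightarrow> 'c \<times> nat" where
  "pred_sym A = (atom_pred A, length (atom_args A))"

primrec lit_preds :: "('c, 'v) lit \<Rightarrow> ('c \<times> nat) set" where
  "lit_preds (Pos A) = {pred_sym A}"
| "lit_preds (Neg A) = {pred_sym A}"
| "lit_preds (Cmp t1 c t2) = {}"

definition agg_preds :: "('c, 'v) agg \<Rightarrow> ('c \<times> nat) set" where
  "agg_preds E = (\<Union>L\<in>set (agg_cond E). lit_preds L)"

primrec body_lit_preds :: "('c, 'v) body_lit \<Rightarrow> ('c \<times> nat) set" where
  "body_lit_preds (Lit L) = lit_preds L"
| "body_lit_preds (PosAgg E) = agg_preds E"
| "body_lit_preds (NegAgg E) = agg_preds E"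

definition head_preds :: "('c, 'v) rule \<Rightarrow> ('c \<times> nat) set" where
  "head_preds R = pred_sym ` set (head R)"

definition body_preds :: "('c, 'v) rule \<Rightarrow> ('c \<times> nat) set" where
  "body_preds R = (\<Union>B\<in>set (body R). body_lit_preds B)"

definition dependency_edges :: "('c, 'v) rule set \<Rightarrow> (('c \<times> nat) \<times> ('c \<times> nat)) set" where
  "dependency_edges \<Pi> = (\<Union>R\<in>\<Pi>. head_preds R \<times> body_preds R)"

text \<open>
  Paths of length zero make no difference: if \<open>p\<close> occurs both in \<open>B\<close> and in the head
  of \<open>R\<close>, then \<open>(p, p)\<close> is an edge.
\<close>

definition recursive_in ::
  "('c, 'v) rule set \<Rightarrow> ('c, 'v) rule \<Rightarrow> ('c, 'v) body_lit \<Rightarrow> bool" where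
  "recursive_in \<Pi> R B \<longleftrightarrow>
     (\<exists>p\<in>body_lit_preds B. \<exists>q\<in>head_preds R. (p, q) \<in> (dependency_edges \<Pi>)\<^sup>*)"

definition positive_agg :: "('c, 'v) body_lit \<Rightarrow> bool" where
  "positive_agg B \<longleftrightarrow> (\<exists>E. B = PosAgg E \<and> (\<forall>A. Neg A \<notin> set (agg_cond E)))"

end

theory Submission
  imports Defs
begin

text \<open>
  Fix \<open>I\<close> and \<open>J \<subseteq> I\<close>. An aggregate without negation, and likewise an aggregate on whose
  predicates \<open>I\<close> and \<open>J\<close> agree, is satisfied by \<open>J\<close> in the FT-reduct iff its classical meaning
  holds in both \<open>I\<close> and \<open>J\<close>; this is exactly how the FLP-reduct treats it. The two semantics
  therefore only disagree on aggregates that are neither. Given a counterexample \<open>J \<subset> I\<close> to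
  minimality for one semantics, enlarge it to \<open>J'\<close> by putting back all atoms of \<open>I - J\<close> except those
  of one strongly connected component \<open>S\<close> of the dependency graph, chosen so that \<open>I\<close> and \<open>J\<close> agree
  on everything that is reachable from \<open>S\<close> but not in \<open>S\<close>. Only rules with head predicates in \<open>S\<close>
  matter for \<open>J'\<close>. In their bodies \<open>J\<close> and \<open>J'\<close> agree, and nonrecursive aggregates do not
  mention \<open>S\<close>, so the semantics coincide there and \<open>J'\<close> is a counterexample for the other one.
\<close>

section \<open>Satisfaction of the FT-reduct\<close>

text \<open>\<open>FT\<close> rebuilds a \<open>Conj\<close> or \<open>Disj\<close> from an image of
  its own index set, so \<open>sat_BigAnd\<close> and \<open>sat_BigOr\<close> always apply to the
  result.\<close>

lemma small_image: "small ((f :: 'i \<Rightarrow> ('a, 'i) form) ` K)"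
  unfolding small_def by blast

lemma small_empty: "small {}"
  unfolding small_def by blast

lemma sat_FBot: "\<not> sat J FBot"
  by (simp add: sat_BigOr small_empty)

lemma sat_FT_Conj: "sat J (FT I (Conj K f)) \<longleftrightarrow> (\<forall>i\<in>K. sat J (FT I (f i)))"
  by (simp add: sat_BigAnd small_image)

lemma sat_FT_Disj: "sat J (FT I (Disj K f)) \<longleftrightarrow> (\<exists>i\<in>K. sat J (FT I (f i)))"
  by (simp add: sat_BigOr small_image)

lemma sat_FT_Atom: "sat J (FT I (Atom p)) \<longleftrightarrow> p \<in> I \<and> p \<in> J"
  by (simp add: sat_FBot)

lemma sat_FT_Imp:
  "sat J (FT I (Imp F G)) \<longleftrightarrow> sat I (Imp F G) \<and> (sat J (FT I F) \<longrightarrow> sat J (FT I G))"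
  using sat_FBot[of J] by auto

lemma sat_FT_BigAnd:
  assumes "small H"
  shows "sat J (FT I (BigAnd H)) \<longleftrightarrow> (\<forall>F\<in>H. sat J (FT I F))"
  by (subst (2) enum_of_image[OF assms, symmetric]) (simp add: BigAnd_def sat_FT_Conj del: FT.simps)

lemma sat_FT_BigOr:
  assumes "small H"
  shows "sat J (FT I (BigOr H)) \<longleftrightarrow> (\<exists>F\<in>H. sat J (FT I F))"
  by (subst (2) enum_of_image[OF assms, symmetric]) (simp add: BigOr_def sat_FT_Disj del: FT.simps)

lemmas sat_FT = sat_FT_Atom sat_FT_Imp sat_FT_BigAnd sat_FT_BigOr

lemma sat_FT_FBot: "\<not> sat J (FT I FBot)"
  by (simp add: sat_FT small_empty del: FT.simps)

text \<open>By induction: atoms and implications that \<open>I\<close> falsifies become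
  \<open>FBot\<close>, which no \<open>J\<close> satisfies.\<close>

lemma sat_FT_imp_sat: "sat J (FT I F) \<Longrightarrow> sat I F"
proof (induction F)
  case (Conj K f)
  then show ?case unfolding sat_FT_Conj by auto
next
  case (Disj K f)
  then show ?case unfolding sat_FT_Disj by auto
qed (auto simp: sat_FT simp del: FT.simps)

lemma sat_FT_self: "sat I (FT I F) \<longleftrightarrow> sat I F"
proof (induction F)
  case (Conj K f)
  then show ?case unfolding sat_FT_Conj by simp
next
  case (Disj K f)
  then show ?case unfolding sat_FT_Disj by simp
qed (auto simp: sat_FT simp del: FT.simps)


section \<open>Aggregates and bodies under the two translations\<close>

primrec gatom_pred :: "'c gatom \<Rightarrow> 'c \<times> nat" where
  "gatom_pred (GAtom c ts) = (c, length ts)"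

definition agree :: "('c \<times> nat) set \<Rightarrow> 'c gatom set \<Rightarrow> 'c gatom set \<Rightarrow> bool" where
  "agree P J I \<longleftrightarrow> (\<forall>a. gatom_pred a \<in> P \<longrightarrow> (a \<in> J \<longleftrightarrow> a \<in> I))"

lemma agree_mono: "agree P J I \<Longrightarrow> Q \<subseteq> P \<Longrightarrow> agree Q J I"
  unfolding agree_def by blast

definition ground_atom :: "('c, 'v) atom \<Rightarrow> 'c gatom" where
  "ground_atom A = GAtom (atom_pred A) (the (vals (atom_args A)))"

lemma tau_atom_ground: "tau_atom A = Atom (ground_atom A)"
  by (simp add: tau_atom_def ground_atom_def)

lemma length_those: "those xs = Some ys \<Longrightarrow> length ys = length xs"
  by (induction xs arbitrary: ys) (auto split: option.splits)

text \<open>Evaluation preserves arity. For an ill-formed atom \<open>the\<close> yields an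
  unspecified list, possibly of another length, hence the hypothesis.\<close>

lemma gatom_pred_ground: "wf_atom A \<Longrightarrow> gatom_pred (ground_atom A) = pred_sym A"
  using length_those[of "map val (atom_args A)"]
  by (auto simp: wf_atom_def wf_tuple_iff ground_atom_def pred_sym_def vals_def)

lemma lit_preds_subst: "lit_preds (subst_lit \<theta> L) = lit_preds L"
  by (cases L) (auto simp: pred_sym_def subst_atom_def)

lemma agg_preds_subst: "agg_preds (subst_agg \<theta> E) = agg_preds E"
  by (simp add: agg_preds_def subst_agg_def lit_preds_subst)

lemma body_lit_preds_subst: "body_lit_preds (subst_body_lit \<theta> B) = body_lit_preds B"
  by (cases B) (auto simp: lit_preds_subst agg_preds_subst)

lemma positive_agg_subst:
  assumes "positive_agg B"
  shows "positive_agg (subst_body_lit \<theta> B)"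
proof -
  obtain E where E: "B = PosAgg E" "\<And>A. Neg A \<notin> set (agg_cond E)"
    using assms by (auto simp: positive_agg_def)
  have "Neg A \<noteq> subst_lit \<theta> L" if "L \<in> set (agg_cond E)" for A L
    using E(2) that by (cases L) auto
  then show ?thesis using E(1) by (auto simp: positive_agg_def subst_agg_def)
qed

lemma sat_tau_lit_agree:
  "\<lbrakk>symbolic L; wf_lit L; agree (lit_preds L) J I\<rbrakk> \<Longrightarrow> sat J (tau_lit L) \<longleftrightarrow> sat I (tau_lit L)"
  by (cases L) (auto simp: tau_atom_ground agree_def gatom_pred_ground sat_FBot)

text \<open>For \<open>Neg A\<close> the reduct depends on \<open>I\<close> only, and
  \<open>J \<subseteq> I\<close> makes falsity of \<open>A\<close> in \<open>I\<close> pass to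
  \<open>J\<close>.\<close>

lemma sat_FT_tau_lit:
  assumes "symbolic L" "J \<subseteq> I"
  shows "sat J (FT I (tau_lit L)) \<longleftrightarrow> sat I (tau_lit L) \<and> sat J (tau_lit L)"
  using assms
  by (cases L) (auto simp: tau_atom_ground sat_FT sat_FBot sat_FT_FBot simp del: FT.simps)

lemma small_tau_lits: "small {tau_lit L :: 'c pform | L. L \<in> set Ls \<and> symbolic L}"
  by (rule small_finite) simp

lemma sat_tau_lits: "sat J (tau_lits Ls) \<longleftrightarrow> (\<forall>L\<in>set Ls. symbolic L \<longrightarrow> sat J (tau_lit L))"
  unfolding tau_lits_def sat_BigAnd[OF small_tau_lits] by blast

lemma sat_FT_tau_lits:
  "sat J (FT I (tau_lits Ls)) \<longleftrightarrow> (\<forall>L\<in>set Ls. symbolic L \<longrightarrow> sat J (FT I (tau_lit L)))"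
  unfolding tau_lits_def sat_FT_BigAnd[OF small_tau_lits] by blast

lemma ball_setcompr: "(\<forall>y\<in>{g x | x. P x}. Q y) \<longleftrightarrow> (\<forall>x. P x \<longrightarrow> Q (g x))"
  by blast

lemma bex_setcompr: "(\<exists>y\<in>{g x | x. P x}. Q y) \<longleftrightarrow> (\<exists>x. P x \<and> Q (g x))"
  by blast

lemma sat_FAnd: "sat J (FAnd F G :: 'c pform) \<longleftrightarrow> sat J F \<and> sat J G"
  by (simp add: sat_BigAnd small_finite)

section \<open>Truth of aggregates as a condition on the set of true tuples\<close>

definition true_tuples ::
  "('c pterm \<Rightarrow> 'c pterm \<Rightarrow> bool) \<Rightarrow> ('c, 'v) agg \<Rightarrow> 'c gatom set \<Rightarrow> 'c pterm list set" where
  "true_tuples le E J = {r \<in> admissible le E. sat J (tau_lits (cond_inst E r))}"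

text \<open>The right side has the shape of a satisfied disjunct of \<open>tau1_agg\<close> and of a
  refuted implication of \<open>tau_agg\<close>, so a quantifier over \<open>\<Delta>\<close>
  collapses to one instance.\<close>

lemma eq_Collect_mem_iff:
  "\<Delta> = {r \<in> A. P r} \<longleftrightarrow> \<Delta> \<subseteq> A \<and> (\<forall>r. r \<in> \<Delta> \<longrightarrow> P r) \<and> (\<forall>r. r \<in> A - \<Delta> \<longrightarrow> \<not> P r)"
  by auto

text \<open>The disjunct for \<open>\<Delta>\<close> needs every tuple in \<open>\<Delta>\<close>
  true and every other admissible tuple false, so only \<open>\<Delta> = true_tuples le E J\<close>
  can succeed.\<close>

lemma sat_tau1_agg: "sat J (tau1_agg le E) \<longleftrightarrow> justifies le E (true_tuples le E J)"
proof -
  have "sat J (tau1_agg le E) \<longleftrightarrow> (\<exists>\<Delta>. \<Delta> = true_tuples le E J \<and> justifies le E \<Delta>)"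
    unfolding tau1_agg_def sat_BigOr[OF small_sets] bex_setcompr sat_FAnd
      sat_BigAnd[OF small_tuples] ball_setcompr true_tuples_def eq_Collect_mem_iff
    by (intro arg_cong[where f = Ex] ext) (simp add: sat_FBot, argo)
  then show ?thesis by simp
qed

text \<open>Dually, the implication for \<open>\<Delta>\<close> is refuted only when the true tuples
  are exactly \<open>\<Delta>\<close>; the conjunction fails iff that set is non-justifying.\<close>

lemma sat_tau_agg: "sat J (tau_agg le E) \<longleftrightarrow> justifies le E (true_tuples le E J)"
proof -
  have "sat J (tau_agg le E) \<longleftrightarrow> (\<forall>\<Delta>. \<Delta> = true_tuples le E J \<longrightarrow> justifies le E \<Delta>)"
    unfolding tau_agg_def sat_BigAnd[OF small_sets] ball_setcompr sat.simps
      sat_BigAnd[OF small_tuples] sat_BigOr[OF small_tuples] bex_setcompr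
      true_tuples_def eq_Collect_mem_iff
    by (intro arg_cong[where f = All] ext) blast
  then show ?thesis by simp
qed

text \<open>Each reduced implication demands truth in \<open>I\<close> and an implication between
  reducts in \<open>J\<close>. The first demands add up to \<open>tau_agg\<close> in
  \<open>I\<close>; among the second, only the set of tuples whose reducts hold in \<open>J\<close>
  can give a refutation.\<close>

lemma sat_FT_tau_agg:
  "sat J (FT I (tau_agg le E)) \<longleftrightarrow> sat I (tau_agg le E)
     \<and> justifies le E {r \<in> admissible le E. sat J (FT I (tau_lits (cond_inst E r)))}"
proof -
  let ?imp = "\<lambda>\<Delta>. Imp (BigAnd {tau_lits (cond_inst E r) | r. r \<in> \<Delta>})
     (BigOr {tau_lits (cond_inst E r) | r. r \<in> admissible le E - \<Delta>})"
  let ?T = "{r \<in> admissible le E. sat J (FT I (tau_lits (cond_inst E r)))}"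
  have "sat J (FT I (tau_agg le E)) \<longleftrightarrow>
      (\<forall>\<Delta>. \<Delta> \<subseteq> admissible le E \<and> \<not> justifies le E \<Delta> \<longrightarrow> sat I (?imp \<Delta>))
      \<and> (\<forall>\<Delta>. \<Delta> = ?T \<longrightarrow> justifies le E \<Delta>)"
    unfolding tau_agg_def sat_FT_BigAnd[OF small_sets] ball_setcompr sat_FT_Imp
      sat_FT_BigAnd[OF small_tuples] sat_FT_BigOr[OF small_tuples] bex_setcompr
      eq_Collect_mem_iff all_conj_distrib[symmetric]
    by (intro arg_cong[where f = All] ext) blast
  also have "(\<forall>\<Delta>. \<Delta> \<subseteq> admissible le E \<and> \<not> justifies le E \<Delta> \<longrightarrow> sat I (?imp \<Delta>))
      \<longleftrightarrow> sat I (tau_agg le E)"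
    unfolding tau_agg_def sat_BigAnd[OF small_sets] ball_setcompr ..
  finally show ?thesis by simp
qed

lemma wf_cond_inst: "\<lbrakk>r \<in> admissible le E; L \<in> set (cond_inst E r)\<rbrakk> \<Longrightarrow> wf_lit L"
  by (simp add: admissible_def)

lemma lit_preds_cond_inst: "L \<in> set (cond_inst E r) \<Longrightarrow> lit_preds L \<subseteq> agg_preds E"
  by (auto simp: cond_inst_def agg_preds_def lit_preds_subst)

lemma true_tuples_agree:
  assumes "agree (agg_preds E) J I"
  shows "true_tuples le E J = true_tuples le E I"
proof -
  have "sat J (tau_lit L) \<longleftrightarrow> sat I (tau_lit L)"
    if "r \<in> admissible le E" "L \<in> set (cond_inst E r)" "symbolic L" for r L
    using that assms sat_tau_lit_agree wf_cond_inst lit_preds_cond_inst agree_mono by metis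
  then show ?thesis unfolding true_tuples_def sat_tau_lits by blast
qed

text \<open>Either alternative makes each condition literal equivalent in \<open>J\<close> to its
  reduct: an atom true in \<open>J\<close> is true in \<open>I\<close> because
  \<open>J \<subseteq> I\<close>, and agreement supplies the truth in \<open>I\<close> that
  \<open>sat_FT_tau_lit\<close> asks for.\<close>

lemma sat_FT_tau_agg_classical:
  assumes "J \<subseteq> I"
    and "(\<forall>A. Neg A \<notin> set (agg_cond E)) \<or> agree (agg_preds E) J I"
  shows "sat J (FT I (tau_agg le E)) \<longleftrightarrow> sat I (tau_agg le E) \<and> sat J (tau_agg le E)"
proof -
  have "sat J (FT I (tau_lit L)) \<longleftrightarrow> sat J (tau_lit L)"
    if r: "r \<in> admissible le E" and L: "L \<in> set (cond_inst E r)" and sym: "symbolic L" for r L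
    using assms(2)
  proof
    assume "\<forall>A. Neg A \<notin> set (agg_cond E)"
    moreover obtain L' where "L' \<in> set (agg_cond E)" "L = subst_lit (assign (agg_vars E) r) L'"
      using L by (auto simp: cond_inst_def)
    ultimately obtain A where "L = Pos A" using sym by (cases L') auto
    then show ?thesis using assms(1) by (auto simp: tau_atom_ground sat_FT simp del: FT.simps)
  next
    assume "agree (agg_preds E) J I"
    then have "sat J (tau_lit L) \<longleftrightarrow> sat I (tau_lit L)"
      using that sat_tau_lit_agree wf_cond_inst lit_preds_cond_inst agree_mono by metis
    then show ?thesis using sat_FT_tau_lit[OF sym assms(1)] by blast
  qed
  then have "{r \<in> admissible le E. sat J (FT I (tau_lits (cond_inst E r)))} = true_tuples le E J"
    unfolding true_tuples_def sat_tau_lits sat_FT_tau_lits by blast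
  then show ?thesis by (simp add: sat_FT_tau_agg sat_tau_agg)
qed

section \<open>Rule bodies\<close>

lemma sat_tau_body:
  "sat J (tau_body T Bs) \<longleftrightarrow>
     (\<forall>B\<in>set Bs. (\<forall>L. B = Lit L \<longrightarrow> symbolic L) \<longrightarrow> sat J (tau_body_lit T B))"
  unfolding tau_body_def by (subst sat_BigAnd[OF small_finite]) auto

lemma sat_FT_tau_body:
  "sat J (FT I (tau_body T Bs)) \<longleftrightarrow>
     (\<forall>B\<in>set Bs. (\<forall>L. B = Lit L \<longrightarrow> symbolic L) \<longrightarrow> sat J (FT I (tau_body_lit T B)))"
  unfolding tau_body_def by (subst sat_FT_BigAnd[OF small_finite]) auto

lemma sat_tau_body_lit_eq:
  "sat J (tau_body_lit (tau_agg le) B) \<longleftrightarrow> sat J (tau_body_lit (tau1_agg le) B)"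
  by (cases B) (simp_all add: sat_tau_agg sat_tau1_agg)

lemma sat_tau_body_eq: "sat J (tau_body (tau_agg le) Bs) \<longleftrightarrow> sat J (tau_body (tau1_agg le) Bs)"
  by (simp add: sat_tau_body sat_tau_body_lit_eq)

lemma sat_tau_body_lit_agree:
  assumes "agree (body_lit_preds B) J I" "wf_body_lit B" "\<forall>L. B = Lit L \<longrightarrow> symbolic L"
  shows "sat J (tau_body_lit (tau1_agg le) B) \<longleftrightarrow> sat I (tau_body_lit (tau1_agg le) B)"
  using assms sat_tau_lit_agree
  by (cases B) (auto simp: sat_tau1_agg true_tuples_agree sat_FBot)

lemma sat_FT_tau_body_lit:
  assumes "J \<subseteq> I" "\<forall>L. B = Lit L \<longrightarrow> symbolic L"
    and "aggregate_lit B \<longrightarrow> positive_agg B \<or> agree (body_lit_preds B) J I"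
  shows "sat J (FT I (tau_body_lit (tau_agg le) B)) \<longleftrightarrow>
    sat I (tau_body_lit (tau1_agg le) B) \<and> sat J (tau_body_lit (tau1_agg le) B)"
  unfolding sat_tau_body_lit_eq[symmetric]
proof (cases B)
  case (Lit L)
  then show "sat J (FT I (tau_body_lit (tau_agg le) B)) \<longleftrightarrow>
      sat I (tau_body_lit (tau_agg le) B) \<and> sat J (tau_body_lit (tau_agg le) B)"
    using assms sat_FT_tau_lit by simp
next
  case (PosAgg E)
  then show "sat J (FT I (tau_body_lit (tau_agg le) B)) \<longleftrightarrow>
      sat I (tau_body_lit (tau_agg le) B) \<and> sat J (tau_body_lit (tau_agg le) B)"
    using assms sat_FT_tau_agg_classical[of J I E le] by (auto simp: positive_agg_def)
next
  case (NegAgg E)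
  \<comment> \<open>A negated aggregate never satisfies \<open>positive_agg\<close>, so only the
    agreement alternative remains.\<close>
  then have "agree (agg_preds E) J I" using assms(3) by (simp add: positive_agg_def)
  then have "sat J (tau_agg le E) \<longleftrightarrow> sat I (tau_agg le E)"
    by (simp add: sat_tau_agg true_tuples_agree)
  \<comment> \<open>If the aggregate is true in \<open>I\<close>, both sides fail. If it is false in
    \<open>I\<close>, its reduct fails in \<open>J\<close>, and by agreement both sides
    hold.\<close>
  then show "sat J (FT I (tau_body_lit (tau_agg le) B)) \<longleftrightarrow>
      sat I (tau_body_lit (tau_agg le) B) \<and> sat J (tau_body_lit (tau_agg le) B)"
    using NegAgg sat_FT_imp_sat[of J I "tau_agg le E"]
    by (auto simp: sat_FT_Imp sat_FBot sat_FT_FBot simp del: FT.simps)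
qed


section \<open>Ground instances and stability\<close>

text \<open>Both translations range over these instances, so the two semantics can be compared
  instance by instance.\<close>

definition rule_insts ::
  "('c pterm \<Rightarrow> 'c pterm \<Rightarrow> bool) \<Rightarrow> ('c, 'v) rule \<Rightarrow>
     (('c, 'v) body_lit list \<times> ('c, 'v) atom list) set" where
  "rule_insts le R = {(map (subst_body_lit \<theta>) (body R), map (subst_atom \<theta>) (head R)) | \<theta>.
     (\<exists>r. length r = length (global_vars R) \<and> \<theta> = assign (global_vars R) r)
     \<and> (\<forall>B\<in>set (body R). wf_body_lit (subst_body_lit \<theta> B))
     \<and> nontrivial_body le (map (subst_body_lit \<theta>) (body R))
     \<and> (\<forall>H\<in>set (head R). wf_atom (subst_atom \<theta> H))}"

lemma tau_rule_insts:
  "tau_rule T le R =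
     {Imp (tau_body T Bs) (BigOr (tau_atom ` set Hs)) | Bs Hs. (Bs, Hs) \<in> rule_insts le R}"
  unfolding tau_rule_def rule_insts_def by force

text \<open>\<open>R\<close> is kept with each instance because recursion is a property of literals
  of the uninstantiated rule.\<close>

definition program_insts ::
  "('c pterm \<Rightarrow> 'c pterm \<Rightarrow> bool) \<Rightarrow> ('c, 'v) rule set \<Rightarrow>
     (('c, 'v) rule \<times> ('c, 'v) body_lit list \<times> ('c, 'v) atom list) set" where
  "program_insts le \<Pi> = Sigma \<Pi> (rule_insts le)"

lemma tau1_insts:
  "tau1 le \<Pi> = (\<lambda>(R, Bs, Hs). Imp (tau_body (tau1_agg le) Bs) (BigOr (tau_atom ` set Hs)))
     ` program_insts le \<Pi>"
  unfolding tau1_def tau_rule_insts program_insts_def by force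

lemma tau_insts:
  "tau le \<Pi> = (\<lambda>(R, Bs, Hs). Imp (tau_body (tau_agg le) Bs) (BigOr (tau_atom ` set Hs)))
     ` program_insts le \<Pi>"
  unfolding tau_def tau_rule_insts program_insts_def by force

section \<open>Reducts as closure conditions\<close>

lemma sat_head: "sat J (BigOr (tau_atom ` set Hs)) \<longleftrightarrow> ground_atom ` set Hs \<inter> J \<noteq> {}"
  by (auto simp: sat_BigOr small_finite tau_atom_ground)

lemma sat_FT_head:
  "J \<subseteq> I \<Longrightarrow> sat J (FT I (BigOr (tau_atom ` set Hs))) \<longleftrightarrow> ground_atom ` set Hs \<inter> J \<noteq> {}"
  by (auto simp: sat_FT small_finite tau_atom_ground simp del: FT.simps)

text \<open>The first conjunct keeps the instance in the FLP-reduct; the second activates it at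
  \<open>J\<close>.\<close>

definition FLP_body ::
  "('c pterm \<Rightarrow> 'c pterm \<Rightarrow> bool) \<Rightarrow> 'c gatom set \<Rightarrow> ('c, 'v) body_lit list \<Rightarrow> 'c gatom set \<Rightarrow> bool"
  where "FLP_body le I Bs J \<longleftrightarrow>
    sat I (tau_body (tau1_agg le) Bs) \<and> sat J (tau_body (tau1_agg le) Bs)"

definition FT_body ::
  "('c pterm \<Rightarrow> 'c pterm \<Rightarrow> bool) \<Rightarrow> 'c gatom set \<Rightarrow> ('c, 'v) body_lit list \<Rightarrow> 'c gatom set \<Rightarrow> bool"
  where "FT_body le I Bs J \<longleftrightarrow> sat J (FT I (tau_body (tau_agg le) Bs))"

text \<open>With \<open>sat_body = FLP_body le I\<close> or \<open>sat_body = FT_body le I\<close>, these are the subsets of \<open>I\<close>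
  that satisfy the reduct, provided that \<open>I\<close> itself does.\<close>

definition closed_under ::
  "('r \<times> 'b \<times> ('c, 'v) atom list) set \<Rightarrow> ('b \<Rightarrow> 'c gatom set \<Rightarrow> bool) \<Rightarrow> 'c gatom set \<Rightarrow> bool" where
  "closed_under X sat_body J \<longleftrightarrow>
     (\<forall>R Bs Hs. (R, Bs, Hs) \<in> X \<longrightarrow> sat_body Bs J \<longrightarrow> ground_atom ` set Hs \<inter> J \<noteq> {})"

lemma FLP_body_self: "FLP_body le I Bs I \<longleftrightarrow> FT_body le I Bs I"
  by (simp add: FLP_body_def FT_body_def sat_FT_self sat_tau_body_eq)

lemma FLP_body_imp_self: "FLP_body le I Bs J \<Longrightarrow> FLP_body le I Bs I"
  by (simp add: FLP_body_def)

lemma FT_body_imp_self: "FT_body le I Bs J \<Longrightarrow> FLP_body le I Bs I"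
  unfolding FLP_body_def FT_body_def sat_tau_body_eq[symmetric] by (auto dest: sat_FT_imp_sat)

lemma models_FLP:
  "models J (FLP H I) \<longleftrightarrow> (\<forall>F G. Imp F G \<in> H \<longrightarrow> sat I F \<and> sat J F \<longrightarrow> sat J G)"
proof -
  have "models J (FLP H I) \<longleftrightarrow> (\<forall>F G. Imp F G \<in> H \<and> sat I F \<longrightarrow> sat J (Imp F G))"
    unfolding models_def FLP_def by blast
  then show ?thesis by auto
qed

lemma models_FLP_tau1:
  "models J (FLP (tau1 le \<Pi>) I) \<longleftrightarrow> closed_under (program_insts le \<Pi>) (FLP_body le I) J"
proof -
  have mem: "Imp F G \<in> tau1 le \<Pi> \<longleftrightarrow> (\<exists>R Bs Hs. (R, Bs, Hs) \<in> program_insts le \<Pi>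
      \<and> F = tau_body (tau1_agg le) Bs \<and> G = BigOr (tau_atom ` set Hs))" for F G
    unfolding tau1_insts by (auto simp: image_iff Bex_def)
  have "models J (FLP (tau1 le \<Pi>) I) \<longleftrightarrow> (\<forall>R Bs Hs. (R, Bs, Hs) \<in> program_insts le \<Pi> \<longrightarrow>
      FLP_body le I Bs J \<longrightarrow> sat J (BigOr (tau_atom ` set Hs)))"
    unfolding models_FLP mem FLP_body_def by blast
  then show ?thesis
    unfolding closed_under_def sat_head .
qed

text \<open>\<open>sat_FT_Imp\<close> splits each reduced rule into truth of the rule in
  \<open>I\<close>, the same for all \<open>J\<close>, and a closure condition on
  \<open>J\<close>.\<close>

lemma models_FT_tau:
  assumes "J \<subseteq> I"
  shows "models J (FT I ` tau le \<Pi>) \<longleftrightarrow>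
    closed_under (program_insts le \<Pi>) (FLP_body le I) I
    \<and> closed_under (program_insts le \<Pi>) (FT_body le I) J"
proof -
  have "sat J (FT I (Imp (tau_body (tau_agg le) Bs) (BigOr (tau_atom ` set Hs)))) \<longleftrightarrow>
      (FLP_body le I Bs I \<longrightarrow> ground_atom ` set Hs \<inter> I \<noteq> {})
      \<and> (FT_body le I Bs J \<longrightarrow> ground_atom ` set Hs \<inter> J \<noteq> {})"
    for Bs and Hs :: "('a, 'b) atom list"
    unfolding sat_FT_Imp sat.simps sat_head sat_FT_head[OF assms] sat_tau_body_eq
      FLP_body_def FT_body_def by blast
  moreover have "models J (FT I ` tau le \<Pi>) \<longleftrightarrow> (\<forall>R Bs Hs. (R, Bs, Hs) \<in> program_insts le \<Pi> \<longrightarrow>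
      sat J (FT I (Imp (tau_body (tau_agg le) Bs) (BigOr (tau_atom ` set Hs)))))"
    unfolding models_def tau_insts by (auto simp del: FT.simps)
  ultimately show ?thesis
    unfolding closed_under_def by (simp del: FT.simps) blast
qed

lemma FLP_stable_insts:
  "FLP_stable (tau1 le \<Pi>) I \<longleftrightarrow> closed_under (program_insts le \<Pi>) (FLP_body le I) I
    \<and> (\<forall>J. J \<subset> I \<longrightarrow> \<not> closed_under (program_insts le \<Pi>) (FLP_body le I) J)"
  by (simp add: FLP_stable_def minimal_model_def models_FLP_tau1)

text \<open>The first conjunct is that of \<open>FLP_stable_insts\<close>, so only the existence of
  closed proper subsets remains to be compared.\<close>

lemma FT_stable_insts:
  "FT_stable (tau le \<Pi>) I \<longleftrightarrow> closed_under (program_insts le \<Pi>) (FLP_body le I) I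
    \<and> (\<forall>J. J \<subset> I \<longrightarrow> \<not> closed_under (program_insts le \<Pi>) (FT_body le I) J)"
proof -
  have "closed_under (program_insts le \<Pi>) (FT_body le I) I \<longleftrightarrow>
      closed_under (program_insts le \<Pi>) (FLP_body le I) I"
    by (simp add: closed_under_def FLP_body_self)
  then show ?thesis
    by (auto simp: FT_stable_def minimal_model_def models_FT_tau)
qed

lemma rule_insts_preds:
  assumes "(Bs, Hs) \<in> rule_insts le R"
  shows "gatom_pred ` ground_atom ` set Hs \<subseteq> head_preds R"
    and "\<And>B. B \<in> set Bs \<Longrightarrow> body_lit_preds B \<subseteq> body_preds R"
    and "\<And>B. B \<in> set Bs \<Longrightarrow> wf_body_lit B"
  using assms
  by (force simp: rule_insts_def gatom_pred_ground head_preds_def body_preds_def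
      body_lit_preds_subst pred_sym_def subst_atom_def)+

lemma FLP_body_agree:
  assumes "(Bs, Hs) \<in> rule_insts le R" "agree (body_preds R) J J'"
  shows "FLP_body le I Bs J \<longleftrightarrow> FLP_body le I Bs J'"
proof -
  have "sat J (tau_body_lit (tau1_agg le) B) \<longleftrightarrow> sat J' (tau_body_lit (tau1_agg le) B)"
    if "B \<in> set Bs" "\<forall>L. B = Lit L \<longrightarrow> symbolic L" for B
    using that sat_tau_body_lit_agree agree_mono[OF assms(2)] rule_insts_preds[OF assms(1)] by metis
  then show ?thesis unfolding FLP_body_def sat_tau_body by blast
qed

lemma FT_body_eq_FLP_body:
  assumes inst: "(Bs, Hs) \<in> rule_insts le R" and "J \<subseteq> I"
    and agg: "\<And>B. \<lbrakk>B \<in> set (body R); aggregate_lit B\<rbrakk>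
      \<Longrightarrow> positive_agg B \<or> agree (body_lit_preds B) J I"
  shows "FT_body le I Bs J \<longleftrightarrow> FLP_body le I Bs J"
proof -
  obtain \<theta> where Bs: "Bs = map (subst_body_lit \<theta>) (body R)"
    using inst by (auto simp: rule_insts_def)
  have "aggregate_lit B \<longrightarrow> positive_agg B \<or> agree (body_lit_preds B) J I"
    if "B \<in> set Bs" for B
  proof
    assume aB: "aggregate_lit B"
    \<comment> \<open>Substitution changes neither the predicates nor the positivity of a literal,
      so the condition on \<open>B0\<close> passes to its instance.\<close>
    from that obtain B0 where B0: "B0 \<in> set (body R)" "B = subst_body_lit \<theta> B0"
      unfolding Bs by auto
    have "aggregate_lit B0" using aB B0(2) by (cases B0) auto
    then show "positive_agg B \<or> agree (body_lit_preds B) J I"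
      using agg[of B0] B0 positive_agg_subst[of B0 \<theta>] by (auto simp: body_lit_preds_subst)
  qed
  then have "sat J (FT I (tau_body_lit (tau_agg le) B)) \<longleftrightarrow>
      sat I (tau_body_lit (tau1_agg le) B) \<and> sat J (tau_body_lit (tau1_agg le) B)"
    if "B \<in> set Bs" "\<forall>L. B = Lit L \<longrightarrow> symbolic L" for B
    using that sat_FT_tau_body_lit[OF \<open>J \<subseteq> I\<close>] by blast
  then show ?thesis
    unfolding FLP_body_def FT_body_def sat_tau_body sat_FT_tau_body by blast
qed


section \<open>Enlarging a counterexample to minimality\<close>

text \<open>Take \<open>p\<close> in \<open>D\<close> reaching the fewest vertices. Whatever a
  successor \<open>d\<close> in \<open>D\<close> reaches, \<open>p\<close> reaches too, so by
  minimality the two sets coincide and \<open>d\<close> reaches \<open>p\<close>. Finiteness of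
  \<open>E\<close> makes these sets finite, as the cardinality argument requires.\<close>

lemma ex_terminal_in:
  assumes "finite E" "D \<noteq> {}"
  obtains p where "p \<in> D" "\<And>d. d \<in> D \<Longrightarrow> (p, d) \<in> E\<^sup>* \<Longrightarrow> (d, p) \<in> E\<^sup>*"
proof -
  obtain p where p: "p \<in> D" "\<And>d. d \<in> D \<Longrightarrow> card (E\<^sup>* `` {p}) \<le> card (E\<^sup>* `` {d})"
    using assms(2) ex_has_least_nat[of "\<lambda>d. d \<in> D" _ "\<lambda>d. card (E\<^sup>* `` {d})"] by auto
  have "(d, p) \<in> E\<^sup>*" if "d \<in> D" "(p, d) \<in> E\<^sup>*" for d
  proof -
    have "E\<^sup>* `` {p} \<subseteq> insert p (Range E)" by (auto elim: rtranclE)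
    then have "finite (E\<^sup>* `` {p})" using assms(1) by (meson finite_Range finite_insert finite_subset)
    moreover have "E\<^sup>* `` {d} \<subseteq> E\<^sup>* `` {p}" using that by auto
    ultimately have "E\<^sup>* `` {d} = E\<^sup>* `` {p}"
      using p(2)[OF that(1)] by (meson card_seteq)
    then show ?thesis by auto
  qed
  with p(1) that show ?thesis by blast
qed

text \<open>The body conditions \<open>b\<close> and \<open>b'\<close> are abstract so that one
  construction serves both directions of the comparison.\<close>

lemma closed_under_enlarge:
  fixes \<Pi> :: "('c, 'v) rule set"
  assumes fin: "finite (dependency_edges \<Pi>)"
    and closed: "closed_under (program_insts le \<Pi>) b J" and "J \<subset> I"
    and head: "\<And>R Bs Hs J'. \<lbrakk>(R, Bs, Hs) \<in> program_insts le \<Pi>; b' Bs J'\<rbrakk>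
      \<Longrightarrow> ground_atom ` set Hs \<inter> I \<noteq> {}"
    and transfer: "\<And>R Bs Hs J'. \<lbrakk>(R, Bs, Hs) \<in> program_insts le \<Pi>; J \<subseteq> J'; J' \<subseteq> I;
      agree (body_preds R) J J';
      agree {p \<in> body_preds R. \<not> (\<exists>q\<in>head_preds R. (p, q) \<in> (dependency_edges \<Pi>)\<^sup>*)} J' I;
      b' Bs J'\<rbrakk> \<Longrightarrow> b Bs J"
  shows "\<exists>J'\<subset>I. closed_under (program_insts le \<Pi>) b' J'"
proof -
  let ?E = "dependency_edges \<Pi>"
  have "gatom_pred ` (I - J) \<noteq> {}" using \<open>J \<subset> I\<close> by auto
  then obtain p where p: "p \<in> gatom_pred ` (I - J)"
    and terminal: "\<And>d. d \<in> gatom_pred ` (I - J) \<Longrightarrow> (p, d) \<in> ?E\<^sup>* \<Longrightarrow> (d, p) \<in> ?E\<^sup>*"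
    using ex_terminal_in[OF fin] by metis
  define S where "S = {d. (p, d) \<in> ?E\<^sup>* \<and> (d, p) \<in> ?E\<^sup>*}"
  define J' where "J' = {a \<in> I. a \<in> J \<or> gatom_pred a \<notin> S}"
  have "J \<subseteq> J'" using \<open>J \<subset> I\<close> by (auto simp: J'_def)
  have "p \<in> S" by (simp add: S_def)
  \<comment> \<open>Some atom of \<open>I - J\<close> has predicate \<open>p\<close>, which is in
    \<open>S\<close>; this atom is not put back.\<close>
  then have "J' \<subset> I" using p by (auto simp: J'_def)
  have "ground_atom ` set Hs \<inter> J' \<noteq> {}"
    if inst: "(R, Bs, Hs) \<in> program_insts le \<Pi>" and b': "b' Bs J'" for R Bs Hs
  proof
    assume disj: "ground_atom ` set Hs \<inter> J' = {}"
    \<comment> \<open>A head atom of \<open>I\<close> can be missing from \<open>J'\<close> only if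
      its predicate is in \<open>S\<close>; this ties \<open>R\<close> to the component.\<close>
    obtain a where a: "a \<in> ground_atom ` set Hs" "a \<in> I" using head[OF inst b'] by blast
    have "R \<in> \<Pi>" and ri: "(Bs, Hs) \<in> rule_insts le R"
      using inst by (auto simp: program_insts_def)
    have q: "gatom_pred a \<in> head_preds R" using rule_insts_preds(1)[OF ri] a(1) by blast
    have "gatom_pred a \<in> S" using a disj by (auto simp: J'_def)
    then have pq: "(p, gatom_pred a) \<in> ?E\<^sup>*" "(gatom_pred a, p) \<in> ?E\<^sup>*" by (auto simp: S_def)
    have reach: "(p, d) \<in> ?E\<^sup>*" if "d \<in> body_preds R" for d
    proof -
      have "(gatom_pred a, d) \<in> ?E" using q that \<open>R \<in> \<Pi>\<close> by (auto simp: dependency_edges_def)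
      then show ?thesis using pq(1) by simp
    qed
    have "agree (body_preds R) J J'"
      unfolding agree_def
    proof (intro allI impI)
      fix c assume c: "gatom_pred c \<in> body_preds R"
      \<comment> \<open>The predicate of \<open>c\<close> is reachable from \<open>p\<close>, so by
        the choice of \<open>p\<close> it also reaches \<open>p\<close>. Hence no atom with a body
        predicate of \<open>R\<close> was put back.\<close>
      have "gatom_pred c \<in> S" if "c \<in> I - J"
        using terminal[of "gatom_pred c"] reach[OF c] that by (auto simp: S_def)
      then show "c \<in> J \<longleftrightarrow> c \<in> J'" using \<open>J \<subseteq> J'\<close> by (auto simp: J'_def)
    qed
    moreover have "agree {p \<in> body_preds R. \<not> (\<exists>q\<in>head_preds R. (p, q) \<in> ?E\<^sup>*)} J' I"
      unfolding agree_def
    proof (intro allI impI)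
      fix c assume c: "gatom_pred c \<in> {p \<in> body_preds R. \<not> (\<exists>q\<in>head_preds R. (p, q) \<in> ?E\<^sup>*)}"
      have "gatom_pred c \<notin> S"
      proof
        assume "gatom_pred c \<in> S"
        \<comment> \<open>Passing through \<open>p\<close>, a predicate in \<open>S\<close> reaches
          the head of \<open>R\<close>, contrary to the choice of \<open>c\<close>.\<close>
        then have "(gatom_pred c, gatom_pred a) \<in> ?E\<^sup>*"
          using pq(1) unfolding S_def by (auto intro: rtrancl_trans)
        then show False using c q by blast
      qed
      then show "c \<in> J' \<longleftrightarrow> c \<in> I" by (auto simp: J'_def)
    qed
    ultimately have "b Bs J" using transfer inst \<open>J \<subseteq> J'\<close> \<open>J' \<subset> I\<close> b' by blast
    then have "ground_atom ` set Hs \<inter> J \<noteq> {}" using closed inst by (auto simp: closed_under_def)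
    then show False using disj \<open>J \<subseteq> J'\<close> by blast
  qed
  then show ?thesis using \<open>J' \<subset> I\<close> unfolding closed_under_def by blast
qed

lemma finite_dependency_edges: "finite \<Pi> \<Longrightarrow> finite (dependency_edges \<Pi>)"
proof -
  have "finite (lit_preds L)" for L :: "('a, 'b) lit" by (cases L) auto
  then have "finite (body_lit_preds B)" for B :: "('a, 'b) body_lit"
    by (cases B) (auto simp: agg_preds_def)
  then show "finite \<Pi> \<Longrightarrow> finite (dependency_edges \<Pi>)"
    by (simp add: dependency_edges_def head_preds_def body_preds_def)
qed

theorem mainTheorem1:
  fixes le :: "'c pterm \<Rightarrow> 'c pterm \<Rightarrow> bool" and \<Pi> :: "('c, 'v) rule set"
  assumes "term_order le"
    and "finite \<Pi>"
    and "\<And>R B. \<lbrakk>R \<in> \<Pi>; B \<in> set (body R); aggregate_lit B; recursive_in \<Pi> R B\<rbrakk> \<Longrightarrow> positive_agg B"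
  shows "FLP_stable_models le \<Pi> = FT_stable_models le \<Pi>"
proof -
  let ?X = "program_insts le \<Pi>"
  let ?nonrec = "\<lambda>R. {p \<in> body_preds R. \<not> (\<exists>q\<in>head_preds R. (p, q) \<in> (dependency_edges \<Pi>)\<^sup>*)}"
  note fin = finite_dependency_edges[OF assms(2)]
  \<comment> \<open>Recursive aggregate literals are positive by assumption; the predicates of
    nonrecursive ones all lie in \<open>?nonrec R\<close>, where \<open>J\<close> and
    \<open>I\<close> agree.\<close>
  have bodies: "FT_body le I Bs J \<longleftrightarrow> FLP_body le I Bs J"
    if inst: "(R, Bs, Hs) \<in> ?X" and "J \<subseteq> I" and ag: "agree (?nonrec R) J I" for R Bs Hs I J
  proof (rule FT_body_eq_FLP_body)
    show "(Bs, Hs) \<in> rule_insts le R" using inst by (simp add: program_insts_def)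
    fix B assume B: "B \<in> set (body R)" "aggregate_lit B"
    show "positive_agg B \<or> agree (body_lit_preds B) J I"
    proof (cases "recursive_in \<Pi> R B")
      case True
      then show ?thesis using assms(3) B inst by (auto simp: program_insts_def)
    next
      case False
      then have "body_lit_preds B \<subseteq> ?nonrec R"
        using B by (auto simp: recursive_in_def body_preds_def)
      then show ?thesis using agree_mono[OF ag] by blast
    qed
  qed fact
  \<comment> \<open>Chained, these equivalences lead from either body condition at \<open>J'\<close>
    to the other one at \<open>J\<close>.\<close>
  have transfer: "FT_body le I Bs J' \<longleftrightarrow> FLP_body le I Bs J'"
      "FT_body le I Bs J \<longleftrightarrow> FLP_body le I Bs J" "FLP_body le I Bs J \<longleftrightarrow> FLP_body le I Bs J'"
    if inst: "(R, Bs, Hs) \<in> ?X" and "J \<subseteq> J'" "J' \<subseteq> I" and ag: "agree (body_preds R) J J'"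
      and agI: "agree (?nonrec R) J' I" for R Bs Hs I J J'
  proof -
    have "agree (?nonrec R) J I" using ag agI unfolding agree_def by blast
    then show "FT_body le I Bs J \<longleftrightarrow> FLP_body le I Bs J"
      using bodies[OF inst] that by blast
    show "FT_body le I Bs J' \<longleftrightarrow> FLP_body le I Bs J'"
      using bodies[OF inst] that by blast
    show "FLP_body le I Bs J \<longleftrightarrow> FLP_body le I Bs J'"
      using inst ag by (auto simp: program_insts_def FLP_body_agree)
  qed
  have "FLP_stable (tau1 le \<Pi>) I \<longleftrightarrow> FT_stable (tau le \<Pi>) I" for I
  \<comment> \<open>If \<open>I\<close> is not closed, it is stable in neither sense.\<close>
  proof (cases "closed_under ?X (FLP_body le I) I")
    case True
    then have head: "ground_atom ` set Hs \<inter> I \<noteq> {}"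
      if "(R, Bs, Hs) \<in> ?X" "FLP_body le I Bs I" for R Bs Hs
      using that by (auto simp: closed_under_def)
    have "\<exists>J'\<subset>I. closed_under ?X (FT_body le I) J'"
      if "closed_under ?X (FLP_body le I) J" "J \<subset> I" for J
      using fin that
    proof (rule closed_under_enlarge)
      fix R Bs Hs J'
      assume inst: "(R, Bs, Hs) \<in> ?X" and body: "FT_body le I Bs J'"
      \<comment> \<open>A body that holds at \<open>J'\<close> also holds at \<open>I\<close>, and
        \<open>I\<close> is closed.\<close>
      show "ground_atom ` set Hs \<inter> I \<noteq> {}"
        using inst FT_body_imp_self[OF body] by (rule head)
      assume "J \<subseteq> J'" "J' \<subseteq> I" "agree (body_preds R) J J'" "agree (?nonrec R) J' I"
      from transfer[OF inst this] body show "FLP_body le I Bs J" by argo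
    qed
    moreover have "\<exists>J'\<subset>I. closed_under ?X (FLP_body le I) J'"
      if "closed_under ?X (FT_body le I) J" "J \<subset> I" for J
      using fin that
    proof (rule closed_under_enlarge)
      fix R Bs Hs J'
      assume inst: "(R, Bs, Hs) \<in> ?X" and body: "FLP_body le I Bs J'"
      show "ground_atom ` set Hs \<inter> I \<noteq> {}"
        using inst FLP_body_imp_self[OF body] by (rule head)
      assume "J \<subseteq> J'" "J' \<subseteq> I" "agree (body_preds R) J J'" "agree (?nonrec R) J' I"
      from transfer[OF inst this] body show "FT_body le I Bs J" by argo
    qed
    ultimately show ?thesis unfolding FLP_stable_insts FT_stable_insts by metis
  qed (simp add: FLP_stable_insts FT_stable_insts)
  then show ?thesis by (simp add: FLP_stable_models_def FT_stable_models_def)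
qed

end
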